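(* Let $(G,\cdot)$ be a group and let $B\colon G\to G$ be a Rota--Baxter operator. Put $x\circ_B y = xB(x)yB(x)^{-1}$ for $x,y\in G$. Then $(G,\cdot,\circ_B)$ is a skew left brace.
   Context: A Rota--Baxter operator (of weight 1) on a group $G$ is a map $B\colon G\to G$ such that $B(g)B(h)=B(gB(g)hB(g)^{-1})$ for all $g,h\in G$. A skew left brace is a set $A$ with two binary operations $\cdot$ and $\circ$ such that $(A,\cdot)$ and $(A,\circ)$ are groups and $a\circ(b\cdot c)=(a\circ b)\cdot a^{-1}\cdot(a\circ c)$ for all $a,b,c\in A$, where $a^{-1}$ is the inverse of $a$ in $(A,\cdot)$. *)

theory Defs
  imports "HOL-Algebra.Group"
begin

definition rota_baxter_operator :: "('a, 'm) monoid_scheme \<Rightarrow> ('a \<Rightarrow> 'a) \<Rightarrow> bool" where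
  "rota_baxter_operator G B \<longleftrightarrow>
     B \<in> carrier G \<rightarrow> carrier G \<and>
     (\<forall>g\<in>carrier G. \<forall>h\<in>carrier G.
        B g \<otimes>\<^bsub>G\<^esub> B h = B (g \<otimes>\<^bsub>G\<^esub> B g \<otimes>\<^bsub>G\<^esub> h \<otimes>\<^bsub>G\<^esub> inv\<^bsub>G\<^esub> (B g)))"

text \<open>
  A skew left brace is a pair of group structures on one carrier: multiplication in \<open>A\<close> is the
  operation written as a dot, multiplication in \<open>C\<close> is the circle operation.
\<close>
locale skew_left_brace = dot: group A + circ: group C
  for A :: "('a, 'm) monoid_scheme" and C :: "('a, 'n) monoid_scheme" +
  assumes carrier_eq: "carrier C = carrier A"
    and brace_compat: "\<lbrakk>a \<in> carrier A; b \<in> carrier A; c \<in> carrier A\<rbrakk> \<Longrightarrow>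
      a \<otimes>\<^bsub>C\<^esub> (b \<otimes>\<^bsub>A\<^esub> c) = (a \<otimes>\<^bsub>C\<^esub> b) \<otimes>\<^bsub>A\<^esub> inv\<^bsub>A\<^esub> a \<otimes>\<^bsub>A\<^esub> (a \<otimes>\<^bsub>C\<^esub> c)"

text \<open>
  A monoid record must name its unit. The only candidate here is the unit of \<open>G\<close>: the two
  identities of a skew left brace coincide (put \<open>b = c = 1\<close> in the compatibility law).
\<close>
definition circ_struct :: "('a, 'm) monoid_scheme \<Rightarrow> ('a \<Rightarrow> 'a) \<Rightarrow> 'a monoid" where
  "circ_struct G B =
     \<lparr>carrier = carrier G,
      mult = (\<lambda>x y. x \<otimes>\<^bsub>G\<^esub> B x \<otimes>\<^bsub>G\<^esub> y \<otimes>\<^bsub>G\<^esub> inv\<^bsub>G\<^esub> (B x)),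
      one = \<one>\<^bsub>G\<^esub>\<rparr>"

end

theory Submission
  imports Defs
begin

text \<open>
  Write \<open>x \<circ> y = x \<cdot> \<lambda>\<^sub>x y\<close>, where
  \<open>\<lambda>\<^sub>x y = B x \<cdot> y \<cdot> (B x)\<^sup>-\<^sup>1\<close> is conjugation by \<open>B x\<close>. The Rota--Baxter identity says
  exactly that \<open>B (x \<circ> y) = B x \<cdot> B y\<close>, so that \<open>\<lambda>\<close> turns \<open>\<circ>\<close> into composition. This is what
  makes \<open>\<circ>\<close> associative: both bracketings of \<open>x \<circ> y \<circ> z\<close> equal \<open>x \<cdot> \<lambda>\<^sub>x y \<cdot> \<lambda>\<^sub>x (\<lambda>\<^sub>y z)\<close>.
  It also forces \<open>B 1\<close> to be idempotent, hence \<open>B 1 = 1\<close>, which makes \<open>1\<close> the unit of \<open>\<circ>\<close>. The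
  inverse of \<open>x\<close> comes from solving \<open>x \<cdot> \<lambda>\<^sub>x y = 1\<close> for \<open>y\<close>. The compatibility law expresses
  that each \<open>\<lambda>\<^sub>x\<close> is multiplicative.
\<close>

context
  fixes G :: "('a, 'm) monoid_scheme" (structure) and B :: "'a \<Rightarrow> 'a"
  assumes group_G: "group G" and rota_baxter: "rota_baxter_operator G B"
begin

interpretation group G by (fact group_G)

lemma rota_baxter_closed: "x \<in> carrier G \<Longrightarrow> B x \<in> carrier G"
  using rota_baxter by (auto simp: rota_baxter_operator_def)

lemma rota_baxter_mult:
  assumes "x \<in> carrier G" "y \<in> carrier G"
  shows "B (x \<otimes> B x \<otimes> y \<otimes> inv (B x)) = B x \<otimes> B y"
  using rota_baxter assms by (auto simp: rota_baxter_operator_def)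

lemma rota_baxter_one: "B \<one> = \<one>"
proof -
  have "B \<one> \<otimes> B \<one> = B \<one>"
    using rota_baxter_mult[of \<one> \<one>] by (simp add: rota_baxter_closed)
  then show ?thesis
    by (simp add: rota_baxter_closed)
qed

lemma inv_mult_cancel_left:
  assumes "x \<in> carrier G" "y \<in> carrier G"
  shows "inv x \<otimes> (x \<otimes> y) = y" "x \<otimes> (inv x \<otimes> y) = y"
  using assms by (simp_all flip: m_assoc)

lemma circ_assoc:
  assumes "x \<in> carrier G" "y \<in> carrier G" "z \<in> carrier G"
  shows "(x \<otimes>\<^bsub>circ_struct G B\<^esub> y) \<otimes>\<^bsub>circ_struct G B\<^esub> z
    = x \<otimes>\<^bsub>circ_struct G B\<^esub> (y \<otimes>\<^bsub>circ_struct G B\<^esub> z)"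
  using assms
  \<comment> \<open>Reassociating must wait: it would destroy the shape of the argument that
    \<open>rota_baxter_mult\<close> matches.\<close>
  by (simp add: circ_struct_def rota_baxter_mult rota_baxter_closed)
    (simp add: rota_baxter_closed inv_mult_group m_assoc inv_mult_cancel_left)

text \<open>
  The element \<open>y = \<lambda>\<^sub>x\<^sup>-\<^sup>1 (x\<^sup>-\<^sup>1)\<close> is by construction a right inverse of \<open>x\<close>. Applying \<open>B\<close> to
  \<open>x \<circ> y = 1\<close> gives \<open>B y = (B x)\<^sup>-\<^sup>1\<close>, and then \<open>y \<circ> x = \<lambda>\<^sub>x\<^sup>-\<^sup>1 (x\<^sup>-\<^sup>1) \<cdot> \<lambda>\<^sub>x\<^sup>-\<^sup>1 x = 1\<close>.
\<close>

lemma circ_left_inverse: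
  assumes x: "x \<in> carrier G"
  shows "\<exists>y\<in>carrier G. y \<otimes>\<^bsub>circ_struct G B\<^esub> x = \<one>"
proof
  let ?y = "inv (B x) \<otimes> inv x \<otimes> B x"
  show y: "?y \<in> carrier G"
    using x by (simp add: rota_baxter_closed)
  have "x \<otimes> B x \<otimes> ?y \<otimes> inv (B x) = \<one>"
    using x by (simp add: rota_baxter_closed m_assoc inv_mult_cancel_left)
  then have "B x \<otimes> B ?y = \<one>"
    using rota_baxter_mult[OF x y] by (simp add: rota_baxter_one)
  then have "B ?y = inv (B x)"
    using x y by (metis inv_equality inv_inv rota_baxter_closed)
  then have "?y \<otimes>\<^bsub>circ_struct G B\<^esub> x = ?y \<otimes> inv (B x) \<otimes> x \<otimes> B x"
    using x by (simp add: circ_struct_def rota_baxter_closed)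
  also have "\<dots> = \<one>"
    using x by (simp add: rota_baxter_closed m_assoc inv_mult_cancel_left)
  finally show "?y \<otimes>\<^bsub>circ_struct G B\<^esub> x = \<one>" .
qed

lemma group_circ_struct: "group (circ_struct G B)"
proof (rule groupI)
  fix x y z
  assume "x \<in> carrier (circ_struct G B)" "y \<in> carrier (circ_struct G B)"
    "z \<in> carrier (circ_struct G B)"
  then show "x \<otimes>\<^bsub>circ_struct G B\<^esub> y \<otimes>\<^bsub>circ_struct G B\<^esub> z
      = x \<otimes>\<^bsub>circ_struct G B\<^esub> (y \<otimes>\<^bsub>circ_struct G B\<^esub> z)"
    using circ_assoc by (simp add: circ_struct_def)
next
  fix x
  assume "x \<in> carrier (circ_struct G B)"
  then show "\<exists>y\<in>carrier (circ_struct G B). y \<otimes>\<^bsub>circ_struct G B\<^esub> x = \<one>\<^bsub>circ_struct G B\<^esub>"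
    using circ_left_inverse by (simp add: circ_struct_def)
qed (simp_all add: circ_struct_def rota_baxter_closed rota_baxter_one)

text \<open>
  Since \<open>\<lambda>\<^sub>a (b \<cdot> c) = \<lambda>\<^sub>a b \<cdot> \<lambda>\<^sub>a c\<close>, inserting \<open>a\<^sup>-\<^sup>1 \<cdot> a\<close> between the two factors of
  \<open>a \<cdot> \<lambda>\<^sub>a b \<cdot> \<lambda>\<^sub>a c\<close> gives the brace law.
\<close>

lemma circ_mult_compat:
  assumes "a \<in> carrier G" "b \<in> carrier G" "c \<in> carrier G"
  shows "a \<otimes>\<^bsub>circ_struct G B\<^esub> (b \<otimes> c)
    = (a \<otimes>\<^bsub>circ_struct G B\<^esub> b) \<otimes> inv a \<otimes> (a \<otimes>\<^bsub>circ_struct G B\<^esub> c)"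
  using assms
  by (simp add: circ_struct_def rota_baxter_closed m_assoc inv_mult_cancel_left)

end

theorem proposition3p1:
  fixes G :: "('a, 'm) monoid_scheme" and B :: "'a \<Rightarrow> 'a"
  assumes "group G"
    and "rota_baxter_operator G B"
  shows "skew_left_brace G (circ_struct G B)"
proof -
  interpret dot: group G by fact
  interpret circ: group "circ_struct G B"
    using assms by (rule group_circ_struct)
  show ?thesis
  proof
    show "carrier (circ_struct G B) = carrier G"
      by (simp add: circ_struct_def)
  qed (rule circ_mult_compat[OF assms])
qed

end
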